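(* Let $u,v$ be permutations and let $m$ be the minimal positive integer such that $u_i=i$ for all $i>m$. For all integers $k,n$ with $m\le k\le n$, $$\mathfrak{S}_{u\times_n v}(x_1,\ldots,x_k)=\mathfrak{S}_u\cdot S_v(x_1,\ldots,x_k),$$ where $\mathfrak{S}_{u\times_n v}(x_1,\ldots,x_k)$ is obtained from the Schubert polynomial $\mathfrak{S}_{u\times_n v}$ by setting $x_i=0$ for all $i>k$, and $S_v(x_1,\ldots,x_k)$ is obtained from the Stanley symmetric function $S_v(x_1,x_2,\ldots)$ by setting $x_i=0$ for all $i>k$.
   Context: Permutations are bijections $w$ of $\{1,2,3,\ldots\}$ fixing all but finitely many elements, written in one-line notation $w=w_1w_2\cdots$; $\ell(w)$ is the number of inversions. Given permutations $u,v$ and a positive integer $n$ with $u_i=i$ for all $i>n$, the permutation $u\times_n v$ is defined by $(u\times_n v)_i=u_i$ for $1\le i\le n$ and $(u\times_n v)_i=n+v_{i-n}$ for $i>n$. Reduced expressions: a reduced expression for $w$ is a sequence $\rho=(i_p,\ldots,i_1)$ of positive integers with $p=\ell(w)$ such that, starting from the one-line notation of the identity and successively exchanging the entries in positions $i_1,i_1+1$, then in positions $i_2,i_2+1$, and so on up to positions $i_p,i_p+1$, one obtains $w$. Write $\rho_j=i_j$ (entries are indexed from right to left). $R(w)$ is the set of reduced expressions for $w$. Schubert polynomial: for $\rho\in R(w)$, a sequence $\alpha=(\alpha_1,\ldots,\alpha_{\ell(w)})$ of positive integers is $\rho$-compatible if $\alpha$ is weakly increasing, $\alpha_j<\alpha_{j+1}$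 whenever $\rho_j<\rho_{j+1}$, and $\alpha_j\le\rho_j$ for all $j$. Then $\mathfrak{S}_w=\sum_{\rho\in R(w)}\sum_{\alpha\ \rho\text{-compatible}}x_{\alpha_1}\cdots x_{\alpha_{\ell(w)}}$. Stanley symmetric function: the run decomposition of $\rho=(i_p,\ldots,i_1)$ cuts the word $i_p,\ldots,i_1$, read from left to right as written, into maximal increasing consecutive runs, denoted $(\rho^{(q)}|\cdots|\rho^{(1)})$, so $\rho^{(q)}$ is the leftmost run. Set $\mathrm{Des}(\rho)=(|\rho^{(1)}|,\ldots,|\rho^{(q)}|)$, a strong composition (finite sequence of positive integers). For a strong composition $\alpha$, the fundamental quasisymmetric function is $F_\alpha(x_1,x_2,\ldots)=\sum_b x^b$, the sum over all sequences $b=(b_1,b_2,\ldots)$ of nonnegative integers with finitely many nonzero terms such that $\mathrm{flat}(b)$ (the strong composition obtained by deleting zeros) refines $\alpha$, where $x^b=\prod_i x_i^{b_i}$; here $\beta$ refines $\alpha$ if $\alpha$ is obtained from $\beta$ by summing consecutive blocks of parts. Then $S_w(x_1,x_2,\ldots)=\sum_{\rho\in R(w)}F_{\mathrm{Des}(\rho)}(x_1,x_2,\ldots)$. *)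

theory Defs
  imports "HOL-Library.Poly_Mapping" "HOL-Combinatorics.Permutations"
begin

text \<open>
  A bijection of the positive integers is represented by its extension to \<open>nat\<close> fixing \<open>0\<close>;
  the entry \<open>w\<^sub>i\<close> of the one-line notation is \<open>w i\<close> for \<open>i \<ge> 1\<close>.
\<close>

definition fin_perm :: "(nat \<Rightarrow> nat) \<Rightarrow> bool" where
  "fin_perm w \<longleftrightarrow> w permutes {1..} \<and> finite {i. w i \<noteq> i}"

definition perm_len :: "(nat \<Rightarrow> nat) \<Rightarrow> nat" where
  "perm_len w = card {(i, j). 1 \<le> i \<and> i < j \<and> w j < w i}"

definition perm_times :: "nat \<Rightarrow> (nat \<Rightarrow> nat) \<Rightarrow> (nat \<Rightarrow> nat) \<Rightarrow> nat \<Rightarrow> nat" where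
  "perm_times n u v = (\<lambda>i. if i \<le> n then u i else n + v (i - n))"


text \<open>
  The word \<open>\<rho> = (i\<^sub>p, \<dots>, i\<^sub>1)\<close> is the list \<open>[i\<^sub>p, \<dots>, i\<^sub>1]\<close>, in the order in which it is written,
  so that \<open>foldr\<close> performs the exchange at \<open>i\<^sub>1\<close> first and \<open>\<rho>\<^sub>j\<close> is \<open>rev \<rho> ! (j - 1)\<close>.
\<close>

definition exchange :: "nat \<Rightarrow> (nat \<Rightarrow> nat) \<Rightarrow> nat \<Rightarrow> nat" where
  "exchange i w = w \<circ> transpose i (i + 1)"

definition reduced_words :: "(nat \<Rightarrow> nat) \<Rightarrow> nat list set" where
  "reduced_words w =
     {\<rho>. set \<rho> \<subseteq> {1..} \<and> length \<rho> = perm_len w \<and> foldr exchange \<rho> id = w}"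


text \<open>Polynomials over the integers in \<open>x\<^sub>0, x\<^sub>1, x\<^sub>2, \<dots>\<close>; the variable \<open>x\<^sub>0\<close> is never used.\<close>

type_synonym mpoly = "(nat \<Rightarrow>\<^sub>0 nat) \<Rightarrow>\<^sub>0 int"

definition X :: "nat \<Rightarrow> mpoly" where
  "X i = Poly_Mapping.single (Poly_Mapping.single i 1) 1"

text \<open>In the list \<open>\<alpha> = [\<alpha>\<^sub>1, \<dots>, \<alpha>\<^sub>p]\<close> positions count from \<open>0\<close>, whence the index shift.\<close>

definition compatible :: "nat list \<Rightarrow> nat list set" where
  "compatible \<rho> =
     {\<alpha>. length \<alpha> = length \<rho> \<and> set \<alpha> \<subseteq> {1..} \<and> sorted \<alpha> \<and>
         (\<forall>j. Suc j < length \<rho> \<longrightarrow> rev \<rho> ! j < rev \<rho> ! Suc j \<longrightarrow> \<alpha> ! j < \<alpha> ! Suc j) \<and>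
         (\<forall>j < length \<rho>. \<alpha> ! j \<le> rev \<rho> ! j)}"

definition schubert :: "(nat \<Rightarrow> nat) \<Rightarrow> mpoly" where
  "schubert w = (\<Sum>\<rho> \<in> reduced_words w. \<Sum>\<alpha> \<in> compatible \<rho>. prod_list (map X \<alpha>))"


text \<open>
  Formal power series in infinitely many variables, given by their coefficient functions
  on exponent vectors.
\<close>

type_synonym mseries = "(nat \<Rightarrow>\<^sub>0 nat) \<Rightarrow> int"

fun runs :: "nat list \<Rightarrow> nat list list" where
  "runs [] = []"
| "runs [x] = [[x]]"
| "runs (x # y # xs) =
     (if x < y then (x # hd (runs (y # xs))) # tl (runs (y # xs))
      else [x] # runs (y # xs))"

text \<open>The reversal is due to \<open>\<rho>\<^sup>(\<^sup>1\<^sup>)\<close> being the rightmost run.\<close>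

definition Des :: "nat list \<Rightarrow> nat list" where
  "Des \<rho> = rev (map length (runs \<rho>))"

definition refines :: "nat list \<Rightarrow> nat list \<Rightarrow> bool" where
  "refines \<beta> \<alpha> \<longleftrightarrow> (\<exists>bs. [] \<notin> set bs \<and> concat bs = \<beta> \<and> map sum_list bs = \<alpha>)"

definition flat :: "(nat \<Rightarrow>\<^sub>0 nat) \<Rightarrow> nat list" where
  "flat b = map (Poly_Mapping.lookup b) (sorted_list_of_set (Poly_Mapping.keys b))"

definition fundamental :: "nat list \<Rightarrow> mseries" where
  "fundamental \<alpha> = (\<lambda>b. if Poly_Mapping.keys b \<subseteq> {1..} \<and> refines (flat b) \<alpha> then 1 else 0)"

definition stanley :: "(nat \<Rightarrow> nat) \<Rightarrow> mseries" where
  "stanley w = (\<lambda>b. \<Sum>\<rho> \<in> reduced_words w. fundamental (Des \<rho>) b)"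


text \<open>
  Setting \<open>x\<^sub>i = 0\<close> for all \<open>i > k\<close> deletes the monomials in which such a variable occurs.
  The result is taken as a polynomial, which presupposes that only finitely many monomials
  remain; for the series used here this is shown below.
\<close>

definition set_zero_above :: "nat \<Rightarrow> mseries \<Rightarrow> mpoly" where
  "set_zero_above k f = Abs_poly_mapping (\<lambda>b. if Poly_Mapping.keys b \<subseteq> {..k} then f b else 0)"

lemma lookup_set_zero_above:
  assumes "finite {b. Poly_Mapping.keys b \<subseteq> {..k} \<and> f b \<noteq> 0}"
  shows "Poly_Mapping.lookup (set_zero_above k f) b = (if Poly_Mapping.keys b \<subseteq> {..k} then f b else 0)"
proof -
  have "{b. (if Poly_Mapping.keys b \<subseteq> {..k} then f b else 0) \<noteq> 0} = {b. Poly_Mapping.keys b \<subseteq> {..k} \<and> f b \<noteq> 0}"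
    by auto
  then show ?thesis
    unfolding set_zero_above_def using assms by (subst lookup_Abs_poly_mapping) auto
qed

lemma lookup_set_zero_above_poly:
  "Poly_Mapping.lookup (set_zero_above k (Poly_Mapping.lookup p)) b = (if Poly_Mapping.keys b \<subseteq> {..k} then Poly_Mapping.lookup p b else 0)"
  by (rule lookup_set_zero_above) (rule finite_subset[OF _ finite_lookup[of p]], auto)

lemma concat_runs: "concat (runs \<rho>) = \<rho>" and runs_eq_Nil: "runs \<rho> = [] \<longleftrightarrow> \<rho> = []"
proof (induction \<rho> rule: runs.induct)
  case (3 x y xs)
  {
    case 1
    obtain r rs where "runs (y # xs) = r # rs"
      using 3 by (metis list.exhaust list.distinct(1))
    with 3 show ?case by simp
  next
    case 2
    show ?case by simp
  }
qed auto

lemma sum_list_Des: "sum_list (Des \<rho>) = length \<rho>"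
  by (metis Des_def concat_runs length_concat sum_list_rev)

lemma sum_list_refines: "refines \<beta> \<alpha> \<Longrightarrow> sum_list \<beta> = sum_list \<alpha>"
proof -
  have "sum_list (concat bs) = sum_list (map sum_list bs)" for bs :: "nat list list"
    by (induction bs) auto
  then show "refines \<beta> \<alpha> \<Longrightarrow> sum_list \<beta> = sum_list \<alpha>"
    unfolding refines_def by metis
qed

lemma lookup_le_sum_list_flat: "Poly_Mapping.lookup b i \<le> sum_list (flat b)"
proof (cases "i \<in> Poly_Mapping.keys b")
  case True
  then have "Poly_Mapping.lookup b i \<in> set (flat b)" by (simp add: flat_def)
  then show ?thesis by (intro member_le_sum_list) simp_all
qed (simp add: in_keys_iff)

lemma finite_exponents: "finite {b :: nat \<Rightarrow>\<^sub>0 nat. Poly_Mapping.keys b \<subseteq> {..k} \<and> (\<forall>i. Poly_Mapping.lookup b i \<le> d)}"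
proof (rule finite_imageD)
  show "inj_on Poly_Mapping.lookup {b :: nat \<Rightarrow>\<^sub>0 nat. Poly_Mapping.keys b \<subseteq> {..k} \<and> (\<forall>i. Poly_Mapping.lookup b i \<le> d)}"
    by (simp add: inj_on_def)
  have "finite {f. \<forall>i. (i \<in> {..k} \<longrightarrow> f i \<in> {..d}) \<and> (i \<notin> {..k} \<longrightarrow> f i = (0::nat))}"
    by (rule finite_set_of_finite_funs) auto
  then show "finite (Poly_Mapping.lookup ` {b :: nat \<Rightarrow>\<^sub>0 nat. Poly_Mapping.keys b \<subseteq> {..k} \<and> (\<forall>i. Poly_Mapping.lookup b i \<le> d)})"
    by (rule rev_finite_subset) (auto simp: in_keys_iff subset_iff)
qed

lemma finite_stanley: "finite {b. Poly_Mapping.keys b \<subseteq> {..k} \<and> stanley w b \<noteq> 0}"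
proof (rule finite_subset[OF _ finite_exponents[of k "perm_len w"]], clarify)
  fix b i
  assume "stanley w b \<noteq> 0"
  then obtain \<rho> where "\<rho> \<in> reduced_words w" "fundamental (Des \<rho>) b \<noteq> 0"
    unfolding stanley_def by (meson sum.not_neutral_contains_not_neutral)
  then have "length \<rho> = perm_len w" "refines (flat b) (Des \<rho>)"
    by (auto simp: reduced_words_def fundamental_def split: if_splits)
  then show "Poly_Mapping.lookup b i \<le> perm_len w"
    using lookup_le_sum_list_flat[of b i] by (simp add: sum_list_refines sum_list_Des)
qed

lemma lookup_set_zero_above_stanley:
  "Poly_Mapping.lookup (set_zero_above k (stanley w)) b = (if Poly_Mapping.keys b \<subseteq> {..k} then stanley w b else 0)"
  by (rule lookup_set_zero_above[OF finite_stanley])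

end

theory Submission
  imports Defs "HOL-Library.Product_Lexorder" "HOL-Library.Multiset"
begin

text \<open>
  Both sides enumerate the same combinatorial objects. Write a reduced word \<open>\<rho>\<close> and a sequence \<open>\<alpha>\<close>
  as a list of columns \<open>(\<alpha>\<^sub>j, \<rho>\<^sub>j)\<close>. The compatibility conditions that do not bound \<open>\<alpha>\<close> say that the
  columns are sorted, with \<open>\<alpha>\<close> increasing and, among equal \<open>\<alpha>\<close>, with \<open>\<rho>\<close> decreasing. Such a list is
  called a biword here. The Schubert polynomial is the generating function of the biwords with
  \<open>\<alpha>\<^sub>j \<le> \<rho>\<^sub>j\<close> for all \<open>j\<close> (\<open>schubert_eq_sum_biwords\<close>). The fundamental quasisymmetric function of the
  descent composition of \<open>\<rho>\<close> generates all sequences that form a biword with \<open>\<rho>\<close>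
  (\<open>fundamental_Des\<close>), so the Stanley function in \<open>k\<close> variables is the generating function of the
  biwords with \<open>\<alpha>\<^sub>j \<le> k\<close> (\<open>set_zero_above_stanley_eq_sum_biwords\<close>).

  A reduced word of \<open>perm_times n u v\<close> is a shuffle of a reduced word of \<open>u\<close>, with letters below \<open>n\<close>,
  and a reduced word of \<open>v\<close> shifted by \<open>n\<close>, with letters above \<open>n\<close> (\<open>reduced_words_perm_times\<close>).
  The point is that the letter \<open>n\<close> cannot occur: it would create an inversion between values on
  different sides of \<open>n\<close>, and a reduced word never destroys an inversion.
  Hence a biword of \<open>perm_times n u v\<close> splits into a biword of \<open>u\<close> and a biword of \<open>v\<close>, and since a
  sorted list is determined by its multiset of columns, merging the two by sorting is the inverse.

  It remains to match the bounds on \<open>\<alpha>\<close>. On the left, \<open>\<alpha>\<^sub>j\<close> is bounded by both \<open>\<rho>\<^sub>j\<close> and \<open>k\<close>. For the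
  letters of \<open>u\<close>, which are below \<open>m \<le> k\<close>, this is the bound \<open>\<alpha>\<^sub>j \<le> \<rho>\<^sub>j\<close> of the Schubert polynomial;
  for the shifted letters of \<open>v\<close>, which are above \<open>n \<ge> k\<close>, it is the bound \<open>\<alpha>\<^sub>j \<le> k\<close> of the truncated
  Stanley function.
\<close>

section \<open>Inversions of reduced words\<close>

definition word_perm :: "nat list \<Rightarrow> nat \<Rightarrow> nat" where
  "word_perm \<rho> = foldr exchange \<rho> id"

lemma word_perm_Nil [simp]: "word_perm [] = id"
  and word_perm_Cons [simp]: "word_perm (i # \<rho>) = exchange i (word_perm \<rho>)"
  by (simp_all add: word_perm_def)

definition reduced :: "nat list \<Rightarrow> bool" where
  "reduced \<rho> \<longleftrightarrow> set \<rho> \<subseteq> {1..} \<and> length \<rho> = perm_len (word_perm \<rho>)"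

lemma reduced_words_iff: "\<rho> \<in> reduced_words w \<longleftrightarrow> reduced \<rho> \<and> word_perm \<rho> = w"
  by (auto simp: reduced_words_def reduced_def word_perm_def)

lemma bij_word_perm: "bij (word_perm \<rho>)"
proof (induction \<rho>)
  case Nil
  show ?case unfolding word_perm_Nil by (rule bij_id)
next
  case (Cons i \<rho>)
  then show ?case
    unfolding word_perm_Cons exchange_def by (intro bij_comp) auto
qed

text \<open>
  Inversions are recorded as pairs of values, not of positions: an exchange of adjacent entries
  that puts the larger one first then adds one pair and leaves all others alone, whereas pairs of
  positions would be permuted.
\<close>

definition value_inversions :: "(nat \<Rightarrow> nat) \<Rightarrow> (nat \<times> nat) set" where
  "value_inversions w = {(a, b). a < b \<and> (\<exists>i j. 1 \<le> i \<and> i < j \<and> w i = b \<and> w j = a)}"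

lemma perm_len_eq_card_value_inversions:
  assumes "inj w"
  shows "perm_len w = card (value_inversions w)"
proof -
  have "value_inversions w = (\<lambda>(i, j). (w j, w i)) ` {(i, j). 1 \<le> i \<and> i < j \<and> w j < w i}"
    by (auto simp: value_inversions_def image_iff)
  moreover have "inj_on (\<lambda>(i, j). (w j, w i)) {(i, j). 1 \<le> i \<and> i < j \<and> w j < w i}"
    using assms by (auto simp: inj_on_def)
  ultimately show ?thesis
    by (simp add: perm_len_def card_image)
qed

text \<open>
  The exchanged entries are the only two values whose relative order changes.
\<close>

lemma value_inversions_exchange:
  assumes "1 \<le> i"
  shows "value_inversions (exchange i w) \<subseteq> insert (w i, w (i + 1)) (value_inversions w)"
proof clarify
  fix a b
  assume ab: "(a, b) \<in> value_inversions (exchange i w)"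
    and new: "(a, b) \<notin> value_inversions w"
  then obtain p q where pq: "1 \<le> p" "p < q" "a < b"
    "w (transpose i (i + 1) p) = b" "w (transpose i (i + 1) q) = a"
    by (auto simp: value_inversions_def exchange_def)
  have "1 \<le> transpose i (i + 1) p"
    using assms pq by (auto simp: transpose_def)
  then have "\<not> transpose i (i + 1) p < transpose i (i + 1) q"
    using new pq by (auto simp: value_inversions_def)
  then have "p = i \<and> q = i + 1"
    using pq by (auto simp: transpose_def split: if_splits)
  then show "a = w i \<and> b = w (i + 1)"
    using pq by auto
qed

lemma finite_value_inversions_word_perm:
  assumes "set \<rho> \<subseteq> {1..}"
  shows "finite (value_inversions (word_perm \<rho>)) \<and> card (value_inversions (word_perm \<rho>)) \<le> length \<rho>"
  using assms
proof (induction \<rho>)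
  case Nil
  have "value_inversions (\<lambda>i. i) = {}" by (auto simp: value_inversions_def)
  then show ?case by (simp add: id_def)
next
  case (Cons i \<rho>)
  let ?w = "word_perm \<rho>"
  have fin: "finite (insert (?w i, ?w (i + 1)) (value_inversions ?w))" using Cons by simp
  have sub: "value_inversions (exchange i ?w) \<subseteq> insert (?w i, ?w (i + 1)) (value_inversions ?w)"
    using Cons.prems by (intro value_inversions_exchange) auto
  have "card (value_inversions (exchange i ?w)) \<le> card (insert (?w i, ?w (i + 1)) (value_inversions ?w))"
    by (rule card_mono[OF fin sub])
  also have "\<dots> \<le> Suc (card (value_inversions ?w))" by (rule card_insert_le_m1) auto
  finally show ?case using Cons finite_subset[OF sub fin] by simp
qed

lemma reduced_iff_card_value_inversions:
  "reduced \<rho> \<longleftrightarrow> set \<rho> \<subseteq> {1..} \<and> length \<rho> = card (value_inversions (word_perm \<rho>))"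
  by (simp add: reduced_def perm_len_eq_card_value_inversions bij_is_inj[OF bij_word_perm])

lemma perm_len_word_perm_le: "set \<rho> \<subseteq> {1..} \<Longrightarrow> perm_len (word_perm \<rho>) \<le> length \<rho>"
  using finite_value_inversions_word_perm
  by (simp add: perm_len_eq_card_value_inversions bij_is_inj[OF bij_word_perm])

text \<open>
  Each exchange adds at most one inversion, so a word with as many letters as its permutation has
  inversions must gain one at every exchange and never lose any. In particular, inversions
  persist to the end of a reduced word.
\<close>

lemma reduced_ConsD:
  assumes "reduced (i # \<rho>)"
  shows "reduced \<rho>"
    and "value_inversions (word_perm (i # \<rho>))
           = insert (word_perm \<rho> i, word_perm \<rho> (i + 1)) (value_inversions (word_perm \<rho>))"
    and "word_perm \<rho> i < word_perm \<rho> (i + 1)"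
proof -
  let ?w = "word_perm \<rho>"
  have pos: "1 \<le> i" "set \<rho> \<subseteq> {1..}" using assms by (auto simp: reduced_def)
  have len: "Suc (length \<rho>) = card (value_inversions (exchange i ?w))"
    using assms by (simp add: reduced_iff_card_value_inversions)
  note fin = finite_value_inversions_word_perm[OF pos(2)]
  have sub: "value_inversions (exchange i ?w) \<subseteq> insert (?w i, ?w (i + 1)) (value_inversions ?w)"
    using pos by (intro value_inversions_exchange) auto
  have ins: "card (insert (?w i, ?w (i + 1)) (value_inversions ?w)) \<le> Suc (card (value_inversions ?w))"
    by (rule card_insert_le_m1) auto
  have mono: "card (value_inversions (exchange i ?w)) \<le> card (insert (?w i, ?w (i + 1)) (value_inversions ?w))"
    using fin by (intro card_mono sub) auto
  show "reduced \<rho>"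
    using len ins mono fin pos by (simp add: reduced_iff_card_value_inversions)
  show eq: "value_inversions (word_perm (i # \<rho>)) = insert (?w i, ?w (i + 1)) (value_inversions ?w)"
    unfolding word_perm_Cons by (rule card_subset_eq[OF _ sub]) (use len ins mono fin in auto)
  then show "?w i < ?w (i + 1)"
    by (auto simp: value_inversions_def set_eq_iff)
qed

text \<open>
  Exchanging the same two positions twice in a row cannot put a smaller entry before a larger
  one both times.
\<close>

lemma distinct_adj_reduced: "reduced \<rho> \<Longrightarrow> distinct_adj \<rho>"
proof (induction \<rho>)
  case (Cons i \<rho>)
  show ?case
  proof (cases \<rho>)
    case (Cons j \<sigma>)
    have "i \<noteq> j"
      using reduced_ConsD(3)[OF Cons.prems] reduced_ConsD(3)[OF reduced_ConsD(1)[OF Cons.prems, unfolded Cons]]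
      by (auto simp: Cons exchange_def)
    then show ?thesis using Cons.IH reduced_ConsD(1)[OF Cons.prems] Cons by simp
  qed simp
qed simp

lemma word_perm_le_iff: "n \<notin> set \<rho> \<Longrightarrow> word_perm \<rho> i \<le> n \<longleftrightarrow> i \<le> n"
proof (induction \<rho> arbitrary: i)
  case (Cons j \<rho>)
  have "word_perm (j # \<rho>) i \<le> n \<longleftrightarrow> transpose j (j + 1) i \<le> n"
    using Cons by (simp add: exchange_def)
  also have "\<dots> \<longleftrightarrow> i \<le> n"
    using Cons.prems by (auto simp: transpose_def)
  finally show ?case .
qed simp

text \<open>
  Before the first exchange at \<open>n\<close>, the values \<open>1, \<dots>, n\<close> occupy the first \<open>n\<close> positions. This exchange
  therefore puts a value above \<open>n\<close> before a value that is at most \<open>n\<close>, and in a reduced word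
  that inversion persists.
\<close>

lemma value_inversion_across_letter:
  assumes "reduced \<rho>" and "n \<in> set \<rho>"
  shows "\<exists>(a, b) \<in> value_inversions (word_perm \<rho>). a \<le> n \<and> n < b"
  using assms
proof (induction \<rho>)
  case (Cons i \<rho>)
  show ?case
  proof (cases "n \<in> set \<rho>")
    case True
    then show ?thesis
      using Cons.IH reduced_ConsD(1,2)[OF Cons.prems(1)] by fastforce
  next
    case False
    then have "i = n" using Cons.prems by simp
    moreover have "word_perm \<rho> n \<le> n" "\<not> word_perm \<rho> (n + 1) \<le> n"
      using word_perm_le_iff[OF False, of n] word_perm_le_iff[OF False, of "n + 1"] by simp_all
    ultimately show ?thesis using reduced_ConsD(2)[OF Cons.prems(1)] by force
  qed
qed simp

text \<open>
  A permutation that maps \<open>{1..n}\<close> to itself has no inversion across \<open>n\<close>, so the letter \<open>n\<close>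
  does not occur in its reduced words. This both bounds the letters in the reduced words of a
  finite permutation and makes the words of \<open>perm_times n u v\<close> split at \<open>n\<close>.
\<close>

lemma letter_notin_reduced:
  assumes "reduced \<rho>" and "\<And>i. word_perm \<rho> i \<le> n \<longleftrightarrow> i \<le> n"
  shows "n \<notin> set \<rho>"
proof
  assume "n \<in> set \<rho>"
  then obtain a b where "(a, b) \<in> value_inversions (word_perm \<rho>)" "a \<le> n" "n < b"
    using value_inversion_across_letter[OF assms(1)] by blast
  then obtain i j where "i < j" "word_perm \<rho> j \<le> n" "n < word_perm \<rho> i"
    by (auto simp: value_inversions_def)
  then show False using assms(2)[of i] assms(2)[of j] by simp
qed

lemma fixing_above_le_iff:
  fixes w :: "nat \<Rightarrow> nat"
  assumes "inj w" and "\<forall>i>n. w i = i"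
  shows "w i \<le> n \<longleftrightarrow> i \<le> n"
proof -
  have "w i = i" if "n < w i"
    using assms(2) that injD[OF assms(1), of "w i" i] by simp
  then show ?thesis using assms(2) by (cases "n < i"; cases "n < w i") auto
qed

lemma reduced_words_letters_below:
  assumes "\<rho> \<in> reduced_words w" and "\<forall>i>n. w i = i"
  shows "set \<rho> \<subseteq> {1..<n}"
proof -
  have \<rho>: "reduced \<rho>" "word_perm \<rho> = w" using assms by (auto simp: reduced_words_iff)
  have "inj w" using \<rho> bij_word_perm bij_is_inj by blast
  have "n' \<notin> set \<rho>" if "n \<le> n'" for n'
  proof (rule letter_notin_reduced[OF \<rho>(1)])
    have "\<forall>i>n'. w i = i" using assms(2) that by simp
    then show "word_perm \<rho> i \<le> n' \<longleftrightarrow> i \<le> n'" for i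
      using fixing_above_le_iff[OF \<open>inj w\<close>] \<rho> by auto
  qed
  moreover have "set \<rho> \<subseteq> {1..}" using \<rho> by (simp add: reduced_def)
  ultimately show ?thesis by (meson atLeastLessThan_iff atLeast_iff not_le subset_iff)
qed

lemma finite_reduced_words:
  assumes "finite {i. w i \<noteq> i}"
  shows "finite (reduced_words w)"
proof -
  obtain n where "\<forall>i\<in>{i. w i \<noteq> i}. i \<le> n"
    using assms finite_nat_set_iff_bounded_le by blast
  then have "\<forall>i>n. w i = i" by auto
  then have "reduced_words w \<subseteq> {\<rho>. set \<rho> \<subseteq> {1..<n} \<and> length \<rho> = perm_len w}"
    using reduced_words_letters_below[of _ w n] by (auto simp: reduced_words_def)
  then show ?thesis by (rule finite_subset) (simp add: finite_lists_length_eq)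
qed

section \<open>Reduced words of a product\<close>

text \<open>
  The first \<open>n\<close> entries of \<open>perm_times n u v\<close> are at most \<open>n\<close> and the others at least \<open>n\<close>, so every
  inversion lies within one of the two blocks.
\<close>

lemma perm_len_perm_times:
  assumes "finite (value_inversions u)" "finite (value_inversions v)"
    and "inj u" "inj v" and "\<forall>i>n. u i = i"
  shows "perm_len (perm_times n u v) = perm_len u + perm_len v"
proof -
  let ?I = "\<lambda>w. {(i, j). 1 \<le> i \<and> i < j \<and> w j < w i}"
  let ?sh = "\<lambda>(i, j). (n + i, n + j)"
  have u: "u i \<le> n \<longleftrightarrow> i \<le> n" for i using fixing_above_le_iff assms by blast
  have fin: "finite (?I w)" if "inj w" "finite (value_inversions w)" for w :: "nat \<Rightarrow> nat"
  proof (rule inj_on_finite[of "\<lambda>(i, j). (w j, w i)" _ "value_inversions w"])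
    show "inj_on (\<lambda>(i, j). (w j, w i)) (?I w)" using that by (auto simp: inj_on_def)
  qed (use that in \<open>auto simp: value_inversions_def\<close>)
  have below: "j \<le> n" if "u j < u i" "i < j" for i j
  proof (rule ccontr)
    assume "\<not> j \<le> n"
    then have "n < u i" "u j = j" using that assms(5) by auto
    then show False using that u[of i] assms(5) by auto
  qed
  have "?I (perm_times n u v) = ?I u \<union> ?sh ` ?I v"
  proof (intro equalityI subsetI)
    fix p assume "p \<in> ?I (perm_times n u v)"
    then obtain i j where p: "p = (i, j)"
      and ij: "1 \<le> i" "i < j" "perm_times n u v j < perm_times n u v i" by auto
    show "p \<in> ?I u \<union> ?sh ` ?I v"
    proof (cases "n < i")
      case True
      then have "p = ?sh (i - n, j - n)" "(i - n, j - n) \<in> ?I v"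
        using ij p by (auto simp: perm_times_def)
      then show ?thesis by blast
    next
      case False
      then have "(i, j) \<in> ?I u"
        using ij u[of i] by (auto simp: perm_times_def split: if_splits)
      then show ?thesis using p by blast
    qed
  next
    fix p assume "p \<in> ?I u \<union> ?sh ` ?I v"
    then show "p \<in> ?I (perm_times n u v)"
    proof
      assume "p \<in> ?I u"
      then obtain i j where p: "p = (i, j)" "(i, j) \<in> ?I u" by auto
      then have "j \<le> n" using below by auto
      with p show ?thesis by (auto simp: perm_times_def)
    qed (auto simp: perm_times_def)
  qed
  moreover have "?I u \<inter> ?sh ` ?I v = {}"
    by (auto dest: below)
  moreover have "card (?sh ` ?I v) = card (?I v)" by (rule card_image) (auto simp: inj_on_def)
  ultimately show ?thesis
    using fin assms by (simp add: perm_len_def card_Un_disjoint)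
qed

lemma word_perm_0: "set \<rho> \<subseteq> {1..} \<Longrightarrow> word_perm \<rho> 0 = 0"
  by (induction \<rho>) (simp_all add: exchange_def transpose_def)

lemma word_perm_fixes_above: "set \<rho> \<subseteq> {..<n} \<Longrightarrow> n < i \<Longrightarrow> word_perm \<rho> i = i"
  by (induction \<rho>) (simp_all add: exchange_def transpose_def)

text \<open>
  Letters below \<open>n\<close> and letters above \<open>n\<close> act on disjoint sets of positions, so their relative
  order in the word is immaterial.
\<close>

lemma word_perm_split:
  assumes "n \<notin> set \<rho>"
  shows "word_perm \<rho> = perm_times n (word_perm (filter (\<lambda>r. r < n) \<rho>))
           (word_perm (map (\<lambda>r. r - n) (filter (\<lambda>r. n < r) \<rho>)))"
  using assms
proof (induction \<rho>)
  case Nil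
  show ?case by (auto simp: perm_times_def)
next
  case (Cons i \<rho>)
  then consider "i < n" | "n < i" by fastforce
  then show ?case
  proof cases
    case 1
    then have "exchange i (perm_times n u v) = perm_times n (exchange i u) v" for u v
      by (auto simp: fun_eq_iff exchange_def perm_times_def transpose_def)
    with 1 Cons show ?thesis by simp
  next
    case 2
    then have "exchange i (perm_times n u v) = perm_times n u (exchange (i - n) v)" for u v
      by (auto simp: fun_eq_iff exchange_def perm_times_def transpose_def Suc_diff_le)
    with 2 Cons show ?thesis by simp
  qed
qed

lemma perm_times_eqD:
  assumes "perm_times n u v = perm_times n u' v'" and "v 0 = 0" "v' 0 = 0"
    and "\<forall>i>n. u i = i" "\<forall>i>n. u' i = i"
  shows "u = u' \<and> v = v'"
proof (intro conjI ext)
  fix i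
  show "u i = u' i" using fun_cong[OF assms(1), of i] assms by (cases "i \<le> n") (auto simp: perm_times_def)
  show "v i = v' i" using fun_cong[OF assms(1), of "n + i"] assms by (cases "i = 0") (auto simp: perm_times_def)
qed

text \<open>
  The reduced words of \<open>perm_times n u v\<close> are the shuffles of a reduced word of \<open>u\<close> with a reduced
  word of \<open>v\<close> shifted by \<open>n\<close>. Given that the two subwords evaluate to \<open>u\<close> and \<open>v\<close>, additivity of
  the length makes the shuffle reduced exactly if both subwords are.
\<close>

lemma reduced_words_perm_times:
  assumes "fin_perm u" "fin_perm v" and "\<forall>i>n. u i = i"
  shows "\<rho> \<in> reduced_words (perm_times n u v) \<longleftrightarrow>
    n \<notin> set \<rho> \<and> filter (\<lambda>r. r < n) \<rho> \<in> reduced_words u \<and>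
    map (\<lambda>r. r - n) (filter (\<lambda>r. n < r) \<rho>) \<in> reduced_words v"
    (is "_ \<longleftrightarrow> _ \<and> ?\<sigma> \<in> _ \<and> ?\<tau> \<in> _")
proof -
  have uv: "inj u" "inj v" "u 0 = 0" "v 0 = 0"
    using assms unfolding fin_perm_def by (auto intro: permutes_inj simp: permutes_not_in)
  have pos: "0 < v i" if "0 < i" for i using injD[OF uv(2), of i 0] uv(4) that by (cases "v i") auto
  have pres: "perm_times n u v i \<le> n \<longleftrightarrow> i \<le> n" for i
    using fixing_above_le_iff[OF uv(1) assms(3), of i] pos[of "i - n"] by (auto simp: perm_times_def)
  have add: "perm_len (perm_times n u v) = perm_len u + perm_len v"
    if "set \<sigma> \<subseteq> {1..}" "set \<tau> \<subseteq> {1..}" "word_perm \<sigma> = u" "word_perm \<tau> = v" for \<sigma> \<tau>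
    using finite_value_inversions_word_perm[of \<sigma>] finite_value_inversions_word_perm[of \<tau>] that uv assms(3)
    by (intro perm_len_perm_times) auto
  have len: "length \<rho> = length ?\<sigma> + length ?\<tau>" if "n \<notin> set \<rho>"
    using that by (induction \<rho>) auto
  show ?thesis
  proof
    assume "\<rho> \<in> reduced_words (perm_times n u v)"
    then have \<rho>: "reduced \<rho>" "word_perm \<rho> = perm_times n u v" by (auto simp: reduced_words_iff)
    have n: "n \<notin> set \<rho>" using letter_notin_reduced[OF \<rho>(1)] pres \<rho>(2) by simp
    have \<sigma>: "set ?\<sigma> \<subseteq> {1..}" and \<tau>: "set ?\<tau> \<subseteq> {1..}" using \<rho>(1) by (auto simp: reduced_def)
    have eq: "word_perm ?\<sigma> = u \<and> word_perm ?\<tau> = v"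
    proof (rule perm_times_eqD)
      show "perm_times n (word_perm ?\<sigma>) (word_perm ?\<tau>) = perm_times n u v"
        using word_perm_split[OF n] \<rho> by simp
      show "\<forall>i>n. word_perm ?\<sigma> i = i" by (auto intro: word_perm_fixes_above)
    qed (use \<tau> uv assms word_perm_0 in auto)
    have "length ?\<sigma> + length ?\<tau> = perm_len u + perm_len v"
      using len[OF n] add[OF \<sigma> \<tau>] eq \<rho> by (simp add: reduced_def)
    moreover have "perm_len u \<le> length ?\<sigma>" "perm_len v \<le> length ?\<tau>"
      using perm_len_word_perm_le[OF \<sigma>] perm_len_word_perm_le[OF \<tau>] eq by auto
    \<comment> \<open>The two lengths have the right sum and each is at least the minimum, so both are minimal.\<close>
    ultimately show "n \<notin> set \<rho> \<and> ?\<sigma> \<in> reduced_words u \<and> ?\<tau> \<in> reduced_words v"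
      using n \<sigma> \<tau> eq by (simp add: reduced_words_def word_perm_def)
  next
    assume *: "n \<notin> set \<rho> \<and> ?\<sigma> \<in> reduced_words u \<and> ?\<tau> \<in> reduced_words v"
    have "set \<rho> \<subseteq> {1..}"
    proof
      fix r assume "r \<in> set \<rho>"
      then have "r < n \<or> n < r" using * by (metis nat_neq_iff)
      then have "r \<in> set ?\<sigma> \<or> n < r" using \<open>r \<in> set \<rho>\<close> by auto
      moreover have "set ?\<sigma> \<subseteq> {1..}" using * by (simp add: reduced_words_def)
      ultimately show "r \<in> {1..}" by (auto simp del: set_filter)
    qed
    moreover have "length \<rho> = perm_len (perm_times n u v)"
      using * len add[of ?\<sigma> ?\<tau>] by (simp add: reduced_words_def word_perm_def)
    moreover have "word_perm \<rho> = perm_times n u v"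
      using * word_perm_split[of n \<rho>] by (simp add: reduced_words_def word_perm_def)
    ultimately show "\<rho> \<in> reduced_words (perm_times n u v)" by (simp add: reduced_words_def word_perm_def)
  qed
qed

section \<open>Fundamental quasisymmetric functions\<close>

text \<open>
  Both sides of the refinement condition are lists of block lengths: for \<open>(<)\<close> the blocks are the
  increasing runs of a word, for \<open>(=)\<close> the constant blocks of a sequence. Treating them as instances
  of one function makes refinement a comparison of the places where the two lists are cut.
\<close>

fun cut_lengths :: "('a \<Rightarrow> 'a \<Rightarrow> bool) \<Rightarrow> 'a list \<Rightarrow> nat list" where
  "cut_lengths P [] = []"
| "cut_lengths P [x] = [1]"
| "cut_lengths P (x # y # xs) =
     (if P x y then Suc (hd (cut_lengths P (y # xs))) # tl (cut_lengths P (y # xs))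
      else 1 # cut_lengths P (y # xs))"

lemma cut_lengths_Cons: "\<exists>a as. cut_lengths P (x # xs) = Suc a # as"
  by (cases xs) auto

lemma zero_notin_cut_lengths: "0 \<notin> set (cut_lengths P xs)"
proof (induction P xs rule: cut_lengths.induct)
  case (3 P x y xs)
  moreover obtain a as where "cut_lengths P (y # xs) = Suc a # as"
    using cut_lengths_Cons by metis
  ultimately show ?case by simp
qed simp_all

lemma map_length_runs: "map length (runs \<rho>) = cut_lengths (<) \<rho>"
proof (induction \<rho> rule: runs.induct)
  case (3 x y xs)
  obtain r rs where "runs (y # xs) = r # rs"
    using runs_eq_Nil[of "y # xs"] by (cases "runs (y # xs)") auto
  with 3 have "cut_lengths (<) (y # xs) = length r # map length rs" by (cases "x < y") simp_all
  with \<open>runs (y # xs) = r # rs\<close> show ?case by (cases "x < y") simp_all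
qed simp_all

lemma refines_Nil: "refines \<beta> [] \<longleftrightarrow> \<beta> = []"
  by (auto simp: refines_def)

lemma refines_Cons:
  "refines \<beta> (a # \<alpha>) \<longleftrightarrow> (\<exists>\<gamma> \<beta>'. \<beta> = \<gamma> @ \<beta>' \<and> \<gamma> \<noteq> [] \<and> sum_list \<gamma> = a \<and> refines \<beta>' \<alpha>)"
proof
  assume "refines \<beta> (a # \<alpha>)"
  then obtain bs where bs: "[] \<notin> set bs" "concat bs = \<beta>" "map sum_list bs = a # \<alpha>"
    unfolding refines_def by (elim exE conjE)
  then obtain \<gamma> cs where "bs = \<gamma> # cs" by (cases bs) auto
  with bs have "\<beta> = \<gamma> @ concat cs \<and> \<gamma> \<noteq> [] \<and> sum_list \<gamma> = a \<and> refines (concat cs) \<alpha>"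
    by (auto simp: refines_def)
  then show "\<exists>\<gamma> \<beta>'. \<beta> = \<gamma> @ \<beta>' \<and> \<gamma> \<noteq> [] \<and> sum_list \<gamma> = a \<and> refines \<beta>' \<alpha>" by blast
next
  assume "\<exists>\<gamma> \<beta>'. \<beta> = \<gamma> @ \<beta>' \<and> \<gamma> \<noteq> [] \<and> sum_list \<gamma> = a \<and> refines \<beta>' \<alpha>"
  then obtain \<gamma> \<beta>' where \<gamma>: "\<beta> = \<gamma> @ \<beta>'" "\<gamma> \<noteq> []" "sum_list \<gamma> = a" and "refines \<beta>' \<alpha>"
    by (elim exE conjE)
  from \<open>refines \<beta>' \<alpha>\<close> obtain bs where "[] \<notin> set bs" "concat bs = \<beta>'" "map sum_list bs = \<alpha>"
    unfolding refines_def by (elim exE conjE)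
  with \<gamma> show "refines \<beta> (a # \<alpha>)"
    unfolding refines_def by (intro exI[of _ "\<gamma> # bs"]) simp
qed

lemma refines_Cons_Cons:
  "refines (b # \<beta>) (a # \<alpha>) \<longleftrightarrow> (\<exists>\<delta> \<beta>'. \<beta> = \<delta> @ \<beta>' \<and> b + sum_list \<delta> = a \<and> refines \<beta>' \<alpha>)"
proof
  assume "refines (b # \<beta>) (a # \<alpha>)"
  then obtain \<gamma> \<beta>' where "b # \<beta> = \<gamma> @ \<beta>'" "\<gamma> \<noteq> []" "sum_list \<gamma> = a" "refines \<beta>' \<alpha>"
    unfolding refines_Cons by (elim exE conjE)
  then show "\<exists>\<delta> \<beta>'. \<beta> = \<delta> @ \<beta>' \<and> b + sum_list \<delta> = a \<and> refines \<beta>' \<alpha>"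
    by (cases \<gamma>) auto
next
  assume "\<exists>\<delta> \<beta>'. \<beta> = \<delta> @ \<beta>' \<and> b + sum_list \<delta> = a \<and> refines \<beta>' \<alpha>"
  then obtain \<delta> \<beta>' where "\<beta> = \<delta> @ \<beta>'" "b + sum_list \<delta> = a" "refines \<beta>' \<alpha>"
    by (elim exE conjE)
  then show "refines (b # \<beta>) (a # \<alpha>)"
    unfolding refines_Cons by (intro exI[of _ "b # \<delta>"] exI[of _ \<beta>']) simp
qed

lemma refines_1_1:
  assumes "0 \<notin> set \<beta>"
  shows "refines (Suc 0 # \<beta>) (Suc 0 # \<alpha>) \<longleftrightarrow> refines \<beta> \<alpha>"
proof
  assume "refines (Suc 0 # \<beta>) (Suc 0 # \<alpha>)"
  then obtain \<delta> \<beta>' where "\<beta> = \<delta> @ \<beta>'" "Suc 0 + sum_list \<delta> = Suc 0" "refines \<beta>' \<alpha>"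
    unfolding refines_Cons_Cons by (elim exE conjE)
  with assms show "refines \<beta> \<alpha>" by (cases \<delta>) auto
next
  assume "refines \<beta> \<alpha>"
  then show "refines (Suc 0 # \<beta>) (Suc 0 # \<alpha>)"
    unfolding refines_Cons_Cons by (intro exI[of _ "[]"] exI[of _ \<beta>]) simp
qed

lemma refines_Suc_Suc: "refines (Suc b # \<beta>) (Suc a # \<alpha>) \<longleftrightarrow> refines (b # \<beta>) (a # \<alpha>)"
  by (simp add: refines_Cons_Cons)

lemma refines_1_Suc: "refines (Suc 0 # \<beta>) (Suc (Suc a) # \<alpha>) \<longleftrightarrow> refines \<beta> (Suc a # \<alpha>)"
proof -
  have "Suc 0 + sum_list \<delta> = Suc (Suc a) \<longleftrightarrow> \<delta> \<noteq> [] \<and> sum_list \<delta> = Suc a" for \<delta>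
    by (cases \<delta>) auto
  then show ?thesis by (simp only: refines_Cons_Cons refines_Cons[of \<beta>] conj_assoc)
qed

lemma not_refines_Suc_1: "\<not> refines (Suc (Suc b) # \<beta>) (Suc 0 # \<alpha>)"
  by (simp add: refines_Cons_Cons)

lemma refines_rev: "refines (rev \<beta>) (rev \<alpha>) \<longleftrightarrow> refines \<beta> \<alpha>"
proof -
  have "refines (rev \<beta>) (rev \<alpha>)" if "refines \<beta> \<alpha>" for \<beta> \<alpha>
  proof -
    from that obtain bs where bs: "[] \<notin> set bs" "concat bs = \<beta>" "map sum_list bs = \<alpha>"
      unfolding refines_def by (elim exE conjE)
    moreover have "concat (rev (map rev bs)) = rev (concat bs)" by (simp add: rev_concat rev_map)
    moreover have "map sum_list (rev (map rev bs)) = rev (map sum_list bs)"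
      by (simp add: rev_map comp_def)
    ultimately show ?thesis
      unfolding refines_def by (intro exI[of _ "rev (map rev bs)"]) auto
  qed
  from this[of \<beta> \<alpha>] this[of "rev \<beta>" "rev \<alpha>"] show ?thesis by auto
qed

text \<open>
  One composition refines another exactly if it is cut wherever the other one is.
  The four cases of the induction step say whether each of the two lists is cut after its first element.
\<close>

lemma refines_cut_lengths:
  assumes "length xs = length ys"
  shows "refines (cut_lengths E xs) (cut_lengths P ys) \<longleftrightarrow>
    (\<forall>i. Suc i < length ys \<longrightarrow> E (xs ! i) (xs ! Suc i) \<longrightarrow> P (ys ! i) (ys ! Suc i))"
  using assms
proof (induction xs ys rule: list_induct2)
  case Nil
  show ?case by (simp add: refines_Nil)
next
  case (Cons x xs y ys)
  show ?case
  proof (cases xs)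
    case Nil
    then show ?thesis using Cons.hyps by (simp add: refines_1_1 refines_Nil)
  next
    case xs: (Cons x' xs')
    with Cons.hyps obtain y' ys' where ys: "ys = y' # ys'" by (cases ys) auto
    obtain b \<beta> where b: "cut_lengths E (x' # xs') = Suc b # \<beta>" using cut_lengths_Cons by metis
    obtain a \<alpha> where a: "cut_lengths P (y' # ys') = Suc a # \<alpha>" using cut_lengths_Cons by metis
    have pos: "0 \<notin> set (Suc b # \<beta>)" using zero_notin_cut_lengths b by metis
    have "refines (cut_lengths E (x # xs)) (cut_lengths P (y # ys)) \<longleftrightarrow>
      (E x x' \<longrightarrow> P y y') \<and> refines (cut_lengths E xs) (cut_lengths P ys)"
      using refines_1_1[OF pos] refines_Suc_Suc[of "Suc b" \<beta> "Suc a" \<alpha>]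
        refines_1_Suc[of "Suc b # \<beta>" a \<alpha>] not_refines_Suc_1[of b \<beta> "Suc a # \<alpha>"]
      by (cases "E x x'"; cases "P y y'") (simp_all only: xs ys a b cut_lengths.simps if_True if_False list.sel One_nat_def simp_thms)
    also have "\<dots> \<longleftrightarrow> (\<forall>i. Suc i < length (y # ys) \<longrightarrow>
        E ((x # xs) ! i) ((x # xs) ! Suc i) \<longrightarrow> P ((y # ys) ! i) ((y # ys) ! Suc i))"
      (is "_ \<longleftrightarrow> (\<forall>i. ?Q i)")
    proof -
      have "(\<forall>i. ?Q i) \<longleftrightarrow> ?Q 0 \<and> (\<forall>i. ?Q (Suc i))" by (metis nat.exhaust)
      then show ?thesis unfolding Cons.IH by (simp add: xs ys)
    qed
    finally show ?thesis .
  qed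
qed

lemma sum_list_cut_lengths: "sum_list (cut_lengths P xs) = length xs"
proof (induction P xs rule: cut_lengths.induct)
  case (3 P x y xs)
  moreover obtain a as where "cut_lengths P (y # xs) = Suc a # as"
    using cut_lengths_Cons by metis
  ultimately show ?case by simp
qed simp_all

text \<open>
  In a monotone list equal elements are adjacent, so constant blocks have the lengths given by the
  multiplicities.
\<close>

lemma cut_lengths_eq_sorted:
  fixes xs :: "'a::linorder list"
  assumes "sorted_wrt (\<ge>) xs"
  shows "cut_lengths (=) xs = map (count_list xs) (remdups_adj xs)"
  using assms
proof (induction xs rule: remdups_adj.induct)
  case (3 x y zs)
  show ?case
  proof (cases "x = y")
    case True
    have "x \<notin> set (dropWhile (\<lambda>z. z = x) zs)"
    proof -
      have "sorted_wrt (\<ge>) (dropWhile (\<lambda>z. z = x) zs)"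
        using 3 by (metis sorted_wrt.simps(2) sorted_wrt_append takeWhile_dropWhile_id)
      moreover have "hd (dropWhile (\<lambda>z. z = x) zs) < x" if "dropWhile (\<lambda>z. z = x) zs \<noteq> []"
      proof -
        have "hd (dropWhile (\<lambda>z. z = x) zs) \<in> set zs"
          using that by (meson hd_in_set set_dropWhileD)
        then have "hd (dropWhile (\<lambda>z. z = x) zs) \<le> x" using 3 by auto
        moreover have "hd (dropWhile (\<lambda>z. z = x) zs) \<noteq> x" using hd_dropWhile[OF that] .
        ultimately show ?thesis by simp
      qed
      moreover have "x \<notin> set ds" if "sorted_wrt (\<ge>) ds" "ds \<noteq> [] \<Longrightarrow> hd ds < x" for ds
        using that by (cases ds) auto
      ultimately show ?thesis by blast
    qed
    then show ?thesis
      using 3 True by (auto simp: remdups_adj_Cons')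
  next
    case False
    then have "x \<notin> set (y # zs)" using 3 by auto
    then have "map (count_list (x # y # zs)) (remdups_adj (y # zs))
        = map (count_list (y # zs)) (remdups_adj (y # zs))"
      by (intro map_cong) auto
    moreover have "count_list (x # y # zs) x = 1" using \<open>x \<notin> _\<close> 
      by (auto simp: count_list_0_iff)
    ultimately show ?thesis using 3 False by simp
  qed
qed simp_all

definition exponent :: "nat list \<Rightarrow> nat \<Rightarrow>\<^sub>0 nat" where
  "exponent \<alpha> = (\<Sum>i\<leftarrow>\<alpha>. Poly_Mapping.single i 1)"

lemma lookup_exponent: "Poly_Mapping.lookup (exponent \<alpha>) i = count_list \<alpha> i"
  by (induction \<alpha>) (auto simp: exponent_def lookup_add lookup_single when_def)

lemma keys_exponent: "Poly_Mapping.keys (exponent \<alpha>) = set \<alpha>"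
  by (auto simp: in_keys_iff lookup_exponent count_list_0_iff)

lemma sorted_exponent_inject:
  assumes "sorted \<alpha>" "sorted \<beta>" "exponent \<alpha> = exponent \<beta>"
  shows "\<alpha> = \<beta>"
proof -
  have "mset \<alpha> = mset \<beta>"
    using assms(3) by (intro multiset_eqI) (metis count_mset lookup_exponent)
  then show ?thesis using assms by (metis properties_for_sort)
qed

lemma ex_sorted_exponent: "\<exists>\<alpha>. sorted \<alpha> \<and> exponent \<alpha> = b"
proof -
  have "finite {i. Poly_Mapping.lookup b i > 0}"
    using finite_lookup[of b] by (rule rev_finite_subset) auto
  then have "count (Abs_multiset (Poly_Mapping.lookup b)) = Poly_Mapping.lookup b"
    by (rule count_Abs_multiset)
  moreover obtain xs where "mset xs = Abs_multiset (Poly_Mapping.lookup b)"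
    using ex_mset by blast
  ultimately have "exponent (sort xs) = b"
    by (intro poly_mapping_eqI) (metis count_mset lookup_exponent mset_sort)
  moreover have "sorted (sort xs)" by simp
  ultimately show ?thesis by blast
qed

text \<open>
  The reversals are due to descent compositions being read from the right end of a word, while
  \<^const>\<open>cut_lengths\<close> recurses from the left.
\<close>

lemma flat_exponent:
  assumes "sorted \<alpha>"
  shows "flat (exponent \<alpha>) = rev (cut_lengths (=) (rev \<alpha>))"
proof -
  have distinct: "distinct (remdups_adj \<alpha>)"
    using assms
  proof (induction \<alpha> rule: remdups_adj.induct)
    case (3 x y xs)
    then show ?case by (auto simp: less_le_not_le)
  qed auto
  have "sorted_list_of_set (set (remdups_adj \<alpha>)) = remdups_adj \<alpha>"
    using assms distinct by (intro sorted_list_of_set.idem_if_sorted_distinct) auto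
  then have "flat (exponent \<alpha>) = map (count_list \<alpha>) (remdups_adj \<alpha>)"
    by (simp add: flat_def keys_exponent lookup_exponent)
  moreover have "cut_lengths (=) (rev \<alpha>) = map (count_list (rev \<alpha>)) (remdups_adj (rev \<alpha>))"
    using assms by (intro cut_lengths_eq_sorted) (simp add: sorted_wrt_rev)
  moreover have "count_list (rev \<alpha>) = count_list \<alpha>" by auto
  ultimately show ?thesis by (simp add: rev_map)
qed

text \<open>
  The compatible sequences without the bound by the letters of the word. For a reduced word they
  generate the fundamental quasisymmetric function in the way in which the compatible sequences
  generate the contribution of the word to the Schubert polynomial.
\<close>

definition weakly_compatible :: "nat list \<Rightarrow> nat list set" where
  "weakly_compatible \<rho> =
     {\<alpha>. length \<alpha> = length \<rho> \<and> set \<alpha> \<subseteq> {1..} \<and> sorted \<alpha> \<and>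
         (\<forall>j. Suc j < length \<rho> \<longrightarrow> rev \<rho> ! j < rev \<rho> ! Suc j \<longrightarrow> \<alpha> ! j < \<alpha> ! Suc j)}"

text \<open>
  The runs of \<open>\<rho>\<close> are cut where \<open>\<rho>\<^sub>j \<le> \<rho>\<^sub>j\<^sub>+\<^sub>1\<close>, hence, as adjacent letters differ, exactly where
  compatibility requires \<open>\<alpha>\<^sub>j < \<alpha>\<^sub>j\<^sub>+\<^sub>1\<close>. At a repeated letter the run is cut,
  but compatibility allows equality.
\<close>

lemma refines_flat_exponent_Des:
  assumes "distinct_adj \<rho>" "sorted \<alpha>" "set \<alpha> \<subseteq> {1..}"
  shows "refines (flat (exponent \<alpha>)) (Des \<rho>) \<longleftrightarrow> \<alpha> \<in> weakly_compatible \<rho>"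
proof (cases "length \<alpha> = length \<rho>")
  case False
  then have "\<not> refines (flat (exponent \<alpha>)) (Des \<rho>)"
    using sum_list_refines[of "flat (exponent \<alpha>)" "Des \<rho>"] assms
    by (auto simp: sum_list_Des flat_exponent sum_list_cut_lengths sum_list_rev)
  with False show ?thesis by (simp add: weakly_compatible_def)
next
  case True
  let ?p = "length \<rho>"
  have neq: "\<rho> ! i \<noteq> \<rho> ! Suc i" if "Suc i < ?p" for i
    using assms(1) that by (simp add: distinct_adj_conv_nth)
  \<comment> \<open>Position \<open>j\<close> of a reversed list of length \<open>p\<close> is position \<open>p - 1 - j\<close> of the list, so that the
     adjacent pair \<open>j, j + 1\<close> becomes the adjacent pair starting at \<open>p - 2 - j\<close>.\<close>
  have flip: "(\<forall>i. Suc i < ?p \<longrightarrow> Q i) \<longleftrightarrow> (\<forall>j. Suc j < ?p \<longrightarrow> Q (?p - Suc (Suc j)))" for Q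
  proof safe
    fix i assume *: "\<forall>j. Suc j < ?p \<longrightarrow> Q (?p - Suc (Suc j))" "Suc i < ?p"
    then have "Q (?p - Suc (Suc (?p - Suc (Suc i))))" by simp
    moreover have "?p - Suc (Suc (?p - Suc (Suc i))) = i" using * by simp
    ultimately show "Q i" by simp
  qed simp
  have "refines (flat (exponent \<alpha>)) (Des \<rho>)
      \<longleftrightarrow> refines (cut_lengths (=) (rev \<alpha>)) (cut_lengths (<) \<rho>)"
    using assms by (simp add: flat_exponent Des_def refines_rev map_length_runs)
  also have "\<dots> \<longleftrightarrow> (\<forall>i. Suc i < ?p \<longrightarrow> rev \<alpha> ! i = rev \<alpha> ! Suc i \<longrightarrow> \<rho> ! i < \<rho> ! Suc i)"
    using True by (simp add: refines_cut_lengths)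
  also have "\<dots> \<longleftrightarrow> (\<forall>j. Suc j < ?p \<longrightarrow> rev \<rho> ! j < rev \<rho> ! Suc j \<longrightarrow> \<alpha> ! j < \<alpha> ! Suc j)"
  proof (subst flip, intro all_cong)
    fix j assume j: "Suc j < ?p"
    have i: "Suc (?p - Suc (Suc j)) = ?p - Suc j" using j by simp
    have \<alpha>: "rev \<alpha> ! (?p - Suc (Suc j)) = \<alpha> ! Suc j" "rev \<alpha> ! (?p - Suc j) = \<alpha> ! j"
      using j True by (simp_all add: rev_nth)
    have \<rho>: "\<rho> ! (?p - Suc (Suc j)) = rev \<rho> ! Suc j" "\<rho> ! (?p - Suc j) = rev \<rho> ! j"
      using j by (simp_all add: rev_nth)
    have "\<alpha> ! j \<le> \<alpha> ! Suc j" using assms(2) j True by (simp add: sorted_iff_nth_Suc)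
    moreover have "rev \<rho> ! j \<noteq> rev \<rho> ! Suc j" 
    proof -
      have "Suc (?p - Suc (Suc j)) < ?p" using j by linarith
      from neq[OF this] show ?thesis unfolding i \<rho> by (rule not_sym)
    qed
    ultimately show "(rev \<alpha> ! (?p - Suc (Suc j)) = rev \<alpha> ! Suc (?p - Suc (Suc j)) \<longrightarrow>
        \<rho> ! (?p - Suc (Suc j)) < \<rho> ! Suc (?p - Suc (Suc j)))
      \<longleftrightarrow> (rev \<rho> ! j < rev \<rho> ! Suc j \<longrightarrow> \<alpha> ! j < \<alpha> ! Suc j)"
      unfolding i \<alpha> \<rho> by auto
  qed
  also have "\<dots> \<longleftrightarrow> \<alpha> \<in> weakly_compatible \<rho>"
    using assms True by (simp add: weakly_compatible_def)
  finally show ?thesis .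
qed

text \<open>
  A monomial determines its weakly increasing sequence of indices, so the coefficient is \<open>0\<close> or \<open>1\<close>
  on both sides.
\<close>

lemma fundamental_Des:
  assumes "distinct_adj \<rho>"
  shows "fundamental (Des \<rho>) b = int (card {\<alpha> \<in> weakly_compatible \<rho>. exponent \<alpha> = b})"
proof -
  obtain \<alpha> where \<alpha>: "sorted \<alpha>" "b = exponent \<alpha>" using ex_sorted_exponent by metis
  have "{\<beta> \<in> weakly_compatible \<rho>. exponent \<beta> = b} = (if \<alpha> \<in> weakly_compatible \<rho> then {\<alpha>} else {})"
    using \<alpha> sorted_exponent_inject by (auto simp: weakly_compatible_def)
  moreover have "Poly_Mapping.keys b \<subseteq> {1..} \<and> refines (flat b) (Des \<rho>) \<longleftrightarrow> \<alpha> \<in> weakly_compatible \<rho>"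
    using refines_flat_exponent_Des[OF assms \<alpha>(1)] \<alpha>
    by (auto simp: keys_exponent weakly_compatible_def)
  ultimately show ?thesis by (simp add: fundamental_def)
qed

section \<open>Biwords\<close>

text \<open>
  A pair of a word \<open>\<rho>\<close> and a sequence \<open>\<alpha>\<close> is read as the list of columns \<open>(\<alpha>\<^sub>j, \<rho>\<^sub>j)\<close>. Under the
  lexicographic order that is increasing in \<open>\<alpha>\<close> and decreasing in \<open>\<rho>\<close>, weak compatibility of \<open>\<alpha>\<close>
  just says that the columns are sorted. A sorted list is determined by its multiset
  of columns, which is what makes the splitting of columns invertible.
\<close>

definition column_key :: "nat \<times> nat \<Rightarrow> nat \<times> int" where
  "column_key = (\<lambda>(a, r). (a, - int r))"

lemma inj_column_key: "inj column_key"
  by (auto simp: inj_def column_key_def)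

definition biwords :: "(nat \<Rightarrow> nat) \<Rightarrow> (nat \<times> nat) list set" where
  "biwords w = {L. rev (map snd L) \<in> reduced_words w \<and> fst ` set L \<subseteq> {1..} \<and> sorted (map column_key L)}"

lemma sorted_column_key_iff:
  "sorted (map column_key L) \<longleftrightarrow> sorted (map fst L) \<and>
    (\<forall>j. Suc j < length L \<longrightarrow> snd (L ! j) < snd (L ! Suc j) \<longrightarrow> fst (L ! j) < fst (L ! Suc j))"
proof -
  have "column_key p \<le> column_key q \<longleftrightarrow> fst p \<le> fst q \<and> (snd p < snd q \<longrightarrow> fst p < fst q)" for p q
    by (cases p; cases q) (auto simp: column_key_def)
  then show ?thesis
    by (simp add: sorted_iff_nth_Suc) blast
qed

lemma weakly_compatible_iff_sorted:
  "\<alpha> \<in> weakly_compatible \<rho> \<longleftrightarrow> length \<alpha> = length \<rho> \<and> set \<alpha> \<subseteq> {1..} \<and>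
    sorted (map column_key (zip \<alpha> (rev \<rho>)))"
proof (cases "length \<alpha> = length \<rho>")
  case True
  then show ?thesis
    by (simp add: sorted_column_key_iff weakly_compatible_def)
qed (simp add: weakly_compatible_def)

text \<open>
  The predicate \<open>Q\<close> restricts the columns one at a time. It serves for the bound of \<open>\<alpha>\<^sub>j\<close> by the letter
  \<open>\<rho>\<^sub>j\<close>, for the bound by \<open>k\<close>, and for both.
\<close>

lemma sum_weakly_compatible_eq_sum_biwords:
  assumes "finite (reduced_words w)"
    and fin: "\<And>\<rho>. \<rho> \<in> reduced_words w \<Longrightarrow> finite {\<alpha> \<in> weakly_compatible \<rho>. \<forall>p\<in>set (zip \<alpha> (rev \<rho>)). Q p}"
  shows "(\<Sum>\<rho>\<in>reduced_words w. \<Sum>\<alpha> | \<alpha> \<in> weakly_compatible \<rho> \<and> (\<forall>p\<in>set (zip \<alpha> (rev \<rho>)). Q p). f \<alpha>)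
       = (\<Sum>L | L \<in> biwords w \<and> (\<forall>p\<in>set L. Q p). f (map fst L))"
proof -
  let ?S = "SIGMA \<rho>:reduced_words w. {\<alpha>. \<alpha> \<in> weakly_compatible \<rho> \<and> (\<forall>p\<in>set (zip \<alpha> (rev \<rho>)). Q p)}"
  have "(\<Sum>\<rho>\<in>reduced_words w. \<Sum>\<alpha> | \<alpha> \<in> weakly_compatible \<rho> \<and> (\<forall>p\<in>set (zip \<alpha> (rev \<rho>)). Q p). f \<alpha>)
      = (\<Sum>(\<rho>, \<alpha>)\<in>?S. f \<alpha>)"
    using assms by (intro sum.Sigma) auto
  also have "\<dots> = (\<Sum>L | L \<in> biwords w \<and> (\<forall>p\<in>set L. Q p). f (map fst L))"
  proof (rule sum.reindex_bij_witness[of _ "\<lambda>L. (rev (map snd L), map fst L)" "\<lambda>(\<rho>, \<alpha>). zip \<alpha> (rev \<rho>)"])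
    fix p assume "p \<in> ?S"
    then obtain \<rho> \<alpha> where p: "p = (\<rho>, \<alpha>)" and *: "\<rho> \<in> reduced_words w"
      "\<alpha> \<in> weakly_compatible \<rho>" "\<forall>p\<in>set (zip \<alpha> (rev \<rho>)). Q p" by auto
    then have len: "length \<alpha> = length \<rho>" by (simp add: weakly_compatible_def)
    show "(rev (map snd (case p of (\<rho>, \<alpha>) \<Rightarrow> zip \<alpha> (rev \<rho>))),
        map fst (case p of (\<rho>, \<alpha>) \<Rightarrow> zip \<alpha> (rev \<rho>))) = p"
      using len by (simp add: p)
    have "fst ` set (zip \<alpha> (rev \<rho>)) = set \<alpha>"
      using len by (metis length_rev map_fst_zip set_map)
    then show "(case p of (\<rho>, \<alpha>) \<Rightarrow> zip \<alpha> (rev \<rho>)) \<in> {L \<in> biwords w. \<forall>p\<in>set L. Q p}"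
      using * len by (simp add: p biwords_def weakly_compatible_iff_sorted)
    show "f (map fst (case p of (\<rho>, \<alpha>) \<Rightarrow> zip \<alpha> (rev \<rho>))) = (case p of (\<rho>, \<alpha>) \<Rightarrow> f \<alpha>)"
      using len by (simp add: p)
  next
    fix L assume L: "L \<in> {L \<in> biwords w. \<forall>p\<in>set L. Q p}"
    show "(case (rev (map snd L), map fst L) of (\<rho>, \<alpha>) \<Rightarrow> zip \<alpha> (rev \<rho>)) = L"
      by (simp add: zip_map_fst_snd)
    then show "(rev (map snd L), map fst L) \<in> ?S"
      using L by (simp add: biwords_def weakly_compatible_iff_sorted zip_map_fst_snd)
  qed
  finally show ?thesis .
qed

text \<open>
  Columns with letters below \<open>n\<close> come from \<open>u\<close>, those with letters above \<open>n\<close> from the shifted \<open>v\<close>.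
  Restoring the shift and sorting the two parts together inverts this splitting.
\<close>

definition low :: "nat \<Rightarrow> (nat \<times> nat) list \<Rightarrow> (nat \<times> nat) list" where
  "low n L = filter (\<lambda>p. snd p < n) L"

definition high :: "nat \<Rightarrow> (nat \<times> nat) list \<Rightarrow> (nat \<times> nat) list" where
  "high n L = map (map_prod id (\<lambda>r. r - n)) (filter (\<lambda>p. n < snd p) L)"

definition merge :: "nat \<Rightarrow> (nat \<times> nat) list \<Rightarrow> (nat \<times> nat) list \<Rightarrow> (nat \<times> nat) list" where
  "merge n L M = sort_key column_key (L @ map (map_prod id ((+) n)) M)"

lemma low_high_merge:
  assumes "\<forall>p\<in>set L. snd p < n" "\<forall>p\<in>set M. 0 < snd p"
    and "sorted (map column_key L)" "sorted (map column_key M)"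
  shows "low n (merge n L M) = L" and "high n (merge n L M) = M"
proof -
  let ?M = "map (map_prod id ((+) n)) M"
  have sorted: "sorted (map column_key ?M)"
    using assms(4) by (auto simp: sorted_iff_nth_Suc column_key_def split_beta)
  have "filter (\<lambda>p. snd p < n) L = L" "filter (\<lambda>p. n < snd p) L = []"
    "filter (\<lambda>p. snd p < n) ?M = []" "filter (\<lambda>p. n < snd p) ?M = ?M"
    using assms by (auto simp: filter_empty_conv filter_id_conv)
  then have "low n (merge n L M) = sort_key column_key L"
    and high: "high n (merge n L M) = map (map_prod id (\<lambda>r. r - n)) (sort_key column_key ?M)"
    unfolding low_def high_def merge_def filter_sort filter_append by simp_all
  then show "low n (merge n L M) = L" using assms(3) by (simp add: sort_key_id_if_sorted)
  show "high n (merge n L M) = M"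
    unfolding high sort_key_id_if_sorted[OF sorted] map_map by (rule map_idI) (simp add: prod_eq_iff)
qed

lemma merge_low_high:
  assumes "\<forall>p\<in>set L. snd p \<noteq> n" and "sorted (map column_key L)"
  shows "merge n (low n L) (high n L) = L"
proof -
  have "map (map_prod id ((+) n)) (high n L) = filter (\<lambda>p. n < snd p) L"
    unfolding high_def map_map by (rule map_idI) (auto simp: prod_eq_iff)
  moreover have "filter (\<lambda>p. n < snd p) L = filter (\<lambda>p. \<not> snd p < n) L"
    using assms(1) by (intro filter_cong) (auto simp: not_less le_less)
  ultimately have "merge n (low n L) (high n L)
      = sort_key column_key (filter (\<lambda>p. snd p < n) L @ filter (\<lambda>p. \<not> snd p < n) L)"
    by (simp add: merge_def low_def)
  also have "\<dots> = L"
    using assms(2) inj_column_key by (intro sort_key_inj_key_eq) (auto intro: inj_on_subset)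
  finally show ?thesis .
qed

lemma exponent_append: "exponent (\<alpha> @ \<beta>) = exponent \<alpha> + exponent \<beta>"
  by (simp add: exponent_def)

lemma exponent_mset_cong: "mset \<alpha> = mset \<beta> \<Longrightarrow> exponent \<alpha> = exponent \<beta>"
  by (metis count_mset lookup_exponent poly_mapping_eqI)

lemma set_merge: "set (merge n L M) = set L \<union> map_prod id ((+) n) ` set M"
  by (simp add: merge_def)

lemma exponent_merge: "exponent (map fst (merge n L M)) = exponent (map fst L) + exponent (map fst M)"
proof -
  have "mset (map fst (merge n L M)) = mset (map fst L @ map fst M)"
    by (simp add: merge_def comp_def multiset.map_comp)
  then show ?thesis by (simp add: exponent_mset_cong exponent_append[symmetric])
qed

text \<open>
  Discarding columns keeps the others sorted, so the statement about words,
  \<open>reduced_words_perm_times\<close>, carries over to biwords.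
\<close>

lemma biwords_perm_times_iff:
  assumes "fin_perm u" "fin_perm v" and "\<forall>i>n. u i = i"
  shows "L \<in> biwords (perm_times n u v) \<longleftrightarrow>
    n \<notin> snd ` set L \<and> sorted (map column_key L) \<and> low n L \<in> biwords u \<and> high n L \<in> biwords v"
proof -
  have \<sigma>: "filter (\<lambda>r. r < n) (rev (map snd L)) = rev (map snd (low n L))"
    by (simp add: low_def rev_filter[symmetric] filter_map comp_def)
  have \<tau>: "map (\<lambda>r. r - n) (filter (\<lambda>r. n < r) (rev (map snd L))) = rev (map snd (high n L))"
    by (simp add: high_def rev_filter[symmetric] filter_map rev_map[symmetric] comp_def)
  have sorted: "sorted (map column_key (low n L))" "sorted (map column_key (high n L))"
    if "sorted (map column_key L)"
  proof -
    show "sorted (map column_key (low n L))"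
      using that unfolding low_def by (rule sorted_filter)
    have "sorted (map column_key (filter (\<lambda>p. n < snd p) L))"
      using that by (rule sorted_filter)
    then show "sorted (map column_key (high n L))"
      by (auto simp: high_def sorted_wrt_map column_key_def split_beta elim!: sorted_wrt_mono_rel[rotated])
  qed
  have fst: "fst ` set L \<subseteq> {1..} \<longleftrightarrow> fst ` set (low n L) \<subseteq> {1..} \<and> fst ` set (high n L) \<subseteq> {1..}"
    if "n \<notin> snd ` set L"
  proof -
    have "set L = set (filter (\<lambda>p. snd p < n) L) \<union> set (filter (\<lambda>p. n < snd p) L)"
      using that by force
    moreover have "fst ` set (high n L) = fst ` set (filter (\<lambda>p. n < snd p) L)"
      by (simp add: high_def image_image)
    ultimately show ?thesis unfolding low_def by (metis image_Un Un_subset_iff)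
  qed
  have "rev (map snd L) \<in> reduced_words (perm_times n u v) \<longleftrightarrow> n \<notin> snd ` set L \<and>
      rev (map snd (low n L)) \<in> reduced_words u \<and> rev (map snd (high n L)) \<in> reduced_words v"
    using reduced_words_perm_times[OF assms, of "rev (map snd L)"] by (simp only: \<sigma> \<tau> set_rev set_map)
  then show ?thesis
    unfolding biwords_def mem_Collect_eq using sorted fst by blast
qed

section \<open>Generating functions\<close>

abbreviation monomial :: "nat list \<Rightarrow> mpoly" where
  "monomial \<alpha> \<equiv> Poly_Mapping.single (exponent \<alpha>) 1"

lemma prod_list_X: "prod_list (map X \<alpha>) = monomial \<alpha>"
  by (induction \<alpha>) (simp_all add: exponent_def X_def mult_single)

lemma finite_compatible: "finite (compatible \<rho>)"
proof (rule finite_subset)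
  show "compatible \<rho> \<subseteq> {\<alpha>. set \<alpha> \<subseteq> {..Max (set \<rho>)} \<and> length \<alpha> = length \<rho>}"
  proof (clarsimp simp: compatible_def)
    fix \<alpha> a assume *: "length \<alpha> = length \<rho>" "a \<in> set \<alpha>" "\<forall>j<length \<rho>. \<alpha> ! j \<le> rev \<rho> ! j"
    then obtain j where "j < length \<alpha>" "a = \<alpha> ! j" by (metis in_set_conv_nth)
    then have "a \<le> rev \<rho> ! j" using * by simp
    moreover have "rev \<rho> ! j \<in> set \<rho>" using nth_mem[of j "rev \<rho>"] * \<open>j < length \<alpha>\<close> by simp
    ultimately show "a \<le> Max (set \<rho>)" using Max_ge[OF List.finite_set] le_trans by blast
  qed
qed (simp add: finite_lists_length_eq)

lemma compatible_eq: "compatible \<rho> = {\<alpha> \<in> weakly_compatible \<rho>. \<forall>p\<in>set (zip \<alpha> (rev \<rho>)). fst p \<le> snd p}"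
proof -
  have "(\<forall>p\<in>set (zip \<alpha> (rev \<rho>)). fst p \<le> snd p) \<longleftrightarrow> (\<forall>j<length \<rho>. \<alpha> ! j \<le> rev \<rho> ! j)"
    if "length \<alpha> = length \<rho>" for \<alpha>
    using that by (auto simp: all_set_conv_all_nth)
  then show ?thesis
    unfolding compatible_def weakly_compatible_def set_eq_iff mem_Collect_eq by blast
qed

lemma schubert_eq_sum_biwords:
  assumes "finite (reduced_words w)"
  shows "schubert w = (\<Sum>L | L \<in> biwords w \<and> (\<forall>p\<in>set L. fst p \<le> snd p). monomial (map fst L))"
  unfolding schubert_def prod_list_X compatible_eq
  by (rule sum_weakly_compatible_eq_sum_biwords[OF assms finite_compatible[unfolded compatible_eq]])

lemma set_zero_above_monomial:
  "set_zero_above k (Poly_Mapping.lookup (monomial \<alpha>)) = (if set \<alpha> \<subseteq> {..k} then monomial \<alpha> else 0)"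
proof (rule poly_mapping_eqI)
  fix b
  show "Poly_Mapping.lookup (set_zero_above k (Poly_Mapping.lookup (monomial \<alpha>))) b
      = Poly_Mapping.lookup (if set \<alpha> \<subseteq> {..k} then monomial \<alpha> else 0) b"
    unfolding lookup_set_zero_above_poly
    by (cases "exponent \<alpha> = b") (auto simp: lookup_single_not_eq keys_exponent)
qed

lemma set_zero_above_sum:
  "set_zero_above k (Poly_Mapping.lookup (\<Sum>x\<in>A. p x)) = (\<Sum>x\<in>A. set_zero_above k (Poly_Mapping.lookup (p x)))"
  by (rule poly_mapping_eqI) (simp only: lookup_set_zero_above_poly lookup_sum if_distrib sum.neutral_const split: if_split; simp)

lemma ball_fst_zip_le_iff:
  assumes "\<alpha> \<in> weakly_compatible \<rho>"
  shows "(\<forall>p\<in>set (zip \<alpha> (rev \<rho>)). fst p \<le> k) \<longleftrightarrow> set \<alpha> \<subseteq> {..k}"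
proof -
  have "map fst (zip \<alpha> (rev \<rho>)) = \<alpha>"
    using assms by (simp add: weakly_compatible_def)
  then have "set \<alpha> = fst ` set (zip \<alpha> (rev \<rho>))" by (metis set_map)
  then show ?thesis by (simp add: image_subset_iff)
qed

lemma set_zero_above_schubert_eq_sum_biwords:
  assumes "finite (reduced_words w)"
  shows "set_zero_above k (Poly_Mapping.lookup (schubert w))
    = (\<Sum>L | L \<in> biwords w \<and> (\<forall>p\<in>set L. fst p \<le> snd p \<and> fst p \<le> k). monomial (map fst L))"
proof -
  let ?C = "\<lambda>\<rho>. {\<alpha> \<in> weakly_compatible \<rho>. \<forall>p\<in>set (zip \<alpha> (rev \<rho>)). fst p \<le> snd p \<and> fst p \<le> k}"
  have C: "?C \<rho> = {\<alpha> \<in> compatible \<rho>. set \<alpha> \<subseteq> {..k}}" for \<rho>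
    using ball_fst_zip_le_iff[of _ \<rho> k] unfolding compatible_eq by blast
  have "set_zero_above k (Poly_Mapping.lookup (schubert w))
      = (\<Sum>\<rho>\<in>reduced_words w. \<Sum>\<alpha>\<in>compatible \<rho>. if set \<alpha> \<subseteq> {..k} then monomial \<alpha> else 0)"
    by (simp only: schubert_def prod_list_X set_zero_above_sum set_zero_above_monomial)
  also have "\<dots> = (\<Sum>\<rho>\<in>reduced_words w. \<Sum>\<alpha>\<in>?C \<rho>. monomial \<alpha>)"
    unfolding C by (intro sum.cong refl sum.inter_filter[symmetric] finite_compatible)
  also have "\<dots> = (\<Sum>L | L \<in> biwords w \<and> (\<forall>p\<in>set L. fst p \<le> snd p \<and> fst p \<le> k). monomial (map fst L))"
    using assms by (intro sum_weakly_compatible_eq_sum_biwords) (simp_all add: C finite_compatible)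
  finally show ?thesis .
qed

text \<open>
  The Stanley symmetric function drops the bound \<open>\<alpha>\<^sub>j \<le> \<rho>\<^sub>j\<close>. Cutting off the variables above \<open>k\<close> puts
  the bound \<open>\<alpha>\<^sub>j \<le> k\<close> in its place.
\<close>

lemma set_zero_above_stanley_eq_sum_biwords:
  assumes "finite (reduced_words w)"
  shows "set_zero_above k (stanley w)
    = (\<Sum>L | L \<in> biwords w \<and> (\<forall>p\<in>set L. fst p \<le> k). monomial (map fst L))"
proof -
  let ?C = "\<lambda>\<rho>. {\<alpha> \<in> weakly_compatible \<rho>. \<forall>p\<in>set (zip \<alpha> (rev \<rho>)). fst p \<le> k}"
  have C: "?C \<rho> = {\<alpha> \<in> weakly_compatible \<rho>. set \<alpha> \<subseteq> {..k}}" for \<rho>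
    using ball_fst_zip_le_iff[of _ \<rho> k] by blast
  have fin: "finite (?C \<rho>)" for \<rho>
    unfolding C
    by (rule finite_subset[of _ "{\<alpha>. set \<alpha> \<subseteq> {..k} \<and> length \<alpha> = length \<rho>}"])
      (auto simp: weakly_compatible_def finite_lists_length_eq)
  have "set_zero_above k (stanley w) = (\<Sum>\<rho>\<in>reduced_words w. \<Sum>\<alpha>\<in>?C \<rho>. monomial \<alpha>)"
  proof (rule poly_mapping_eqI)
    fix b
    have coeff: "(\<Sum>\<alpha>\<in>?C \<rho>. Poly_Mapping.lookup (monomial \<alpha>) b)
        = (if Poly_Mapping.keys b \<subseteq> {..k} then fundamental (Des \<rho>) b else 0)"
      if "\<rho> \<in> reduced_words w" for \<rho>
    proof -
      have "(\<Sum>\<alpha>\<in>?C \<rho>. Poly_Mapping.lookup (monomial \<alpha>) b) = (\<Sum>\<alpha>\<in>?C \<rho>. if exponent \<alpha> = b then 1 else 0)"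
        by (intro sum.cong refl) (auto simp: lookup_single when_def)
      also have "\<dots> = int (card {\<alpha> \<in> ?C \<rho>. exponent \<alpha> = b})"
        using fin by (simp flip: sum.inter_filter)
      also have "{\<alpha> \<in> ?C \<rho>. exponent \<alpha> = b}
          = (if Poly_Mapping.keys b \<subseteq> {..k} then {\<alpha> \<in> weakly_compatible \<rho>. exponent \<alpha> = b} else {})"
        unfolding C by (auto simp: keys_exponent)
      also have "int (card \<dots>) = (if Poly_Mapping.keys b \<subseteq> {..k} then fundamental (Des \<rho>) b else 0)"
        using that by (simp add: fundamental_Des distinct_adj_reduced reduced_words_iff)
      finally show ?thesis .
    qed
    show "Poly_Mapping.lookup (set_zero_above k (stanley w)) b
        = Poly_Mapping.lookup (\<Sum>\<rho>\<in>reduced_words w. \<Sum>\<alpha>\<in>?C \<rho>. monomial \<alpha>) b"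
    proof -
      have "Poly_Mapping.lookup (set_zero_above k (stanley w)) b
          = (\<Sum>\<rho>\<in>reduced_words w. if Poly_Mapping.keys b \<subseteq> {..k} then fundamental (Des \<rho>) b else 0)"
        unfolding lookup_set_zero_above_stanley by (simp add: stanley_def)
      also have "\<dots> = (\<Sum>\<rho>\<in>reduced_words w. \<Sum>\<alpha>\<in>?C \<rho>. Poly_Mapping.lookup (monomial \<alpha>) b)"
        by (rule sum.cong[OF refl coeff[symmetric]])
      finally show ?thesis by (simp only: lookup_sum)
    qed
  qed
  also have "\<dots> = (\<Sum>L | L \<in> biwords w \<and> (\<forall>p\<in>set L. fst p \<le> k). monomial (map fst L))"
    using assms fin by (intro sum_weakly_compatible_eq_sum_biwords)
  finally show ?thesis .
qed

lemma biwords_letters_below: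
  assumes "L \<in> biwords w" "\<forall>i>n. w i = i" "p \<in> set L"
  shows "snd p < n"
proof -
  have "set (rev (map snd L)) \<subseteq> {1..<n}"
    using assms(1,2) by (intro reduced_words_letters_below) (auto simp: biwords_def)
  then show ?thesis using assms(3) by auto
qed

lemma biwords_letters_pos: "L \<in> biwords w \<Longrightarrow> p \<in> set L \<Longrightarrow> 0 < snd p"
  by (force simp: biwords_def reduced_words_def)

section \<open>The factorization\<close>

theorem theorem3p2:
  fixes u v :: "nat \<Rightarrow> nat" and k m n :: nat
  assumes "fin_perm u" and "fin_perm v"
    and "m = (LEAST m. 0 < m \<and> (\<forall>i>m. u i = i))"
    and "m \<le> k" and "k \<le> n"
  shows "set_zero_above k (Poly_Mapping.lookup (schubert (perm_times n u v)))
       = schubert u * set_zero_above k (stanley v)"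
proof -
  have fin: "finite {i. u i \<noteq> i}" "finite {i. v i \<noteq> i}" using assms(1,2) by (auto simp: fin_perm_def)
  obtain N where "\<forall>i\<in>{i. u i \<noteq> i}. i \<le> N" using fin(1) finite_nat_set_iff_bounded_le by blast
  then have "0 < Suc N \<and> (\<forall>i>Suc N. u i = i)" by auto
  then have "0 < m \<and> (\<forall>i>m. u i = i)" unfolding assms(3) by (rule LeastI)
  then have m: "\<forall>i>m. u i = i" by (rule conjunct2)
  then have n: "\<forall>i>n. u i = i" using assms(4,5) by simp
  note split = biwords_perm_times_iff[OF assms(1,2) n]
  have "{i. perm_times n u v i \<noteq> i} \<subseteq> {..n} \<union> (+) n ` {i. v i \<noteq> i}"
  proof
    fix i assume "i \<in> {i. perm_times n u v i \<noteq> i}"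
    then have "i \<le> n \<or> i = n + (i - n) \<and> v (i - n) \<noteq> i - n" by (auto simp: perm_times_def)
    then show "i \<in> {..n} \<union> (+) n ` {i. v i \<noteq> i}" by blast
  qed
  then have "finite {i. perm_times n u v i \<noteq> i}" by (rule finite_subset) (simp add: fin)
  note finite = finite_reduced_words[OF fin(1)] finite_reduced_words[OF fin(2)] finite_reduced_words[OF this]
  let ?A = "{L. L \<in> biwords (perm_times n u v) \<and> (\<forall>p\<in>set L. fst p \<le> snd p \<and> fst p \<le> k)}"
  let ?B = "{L. L \<in> biwords u \<and> (\<forall>p\<in>set L. fst p \<le> snd p)}"
  let ?C = "{M. M \<in> biwords v \<and> (\<forall>p\<in>set M. fst p \<le> k)}"
  have low_high: "low n (merge n L M) = L" "high n (merge n L M) = M" if "L \<in> ?B" "M \<in> ?C" for L M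
    using that biwords_letters_below[OF _ n] biwords_letters_pos
    by (auto intro!: low_high_merge simp: biwords_def)
  have "schubert u * set_zero_above k (stanley v)
      = (\<Sum>(L, M)\<in>?B \<times> ?C. monomial (map fst L) * monomial (map fst M))"
    unfolding schubert_eq_sum_biwords[OF finite(1)] set_zero_above_stanley_eq_sum_biwords[OF finite(2)]
    by (simp only: sum_product sum.cartesian_product)
  also have "\<dots> = (\<Sum>L\<in>?A. monomial (map fst L))"
  proof (rule sum.reindex_bij_witness[of _ "\<lambda>L. (low n L, high n L)" "\<lambda>(L, M). merge n L M"])
    fix q assume "q \<in> ?B \<times> ?C"
    then obtain L M where q: "q = (L, M)" and LM: "L \<in> ?B" "M \<in> ?C" by blast
    show "(low n (case q of (L, M) \<Rightarrow> merge n L M), high n (case q of (L, M) \<Rightarrow> merge n L M)) = q"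
      using low_high[OF LM] by (simp add: q)
    show "monomial (map fst (case q of (L, M) \<Rightarrow> merge n L M))
        = (case q of (L, M) \<Rightarrow> monomial (map fst L) * monomial (map fst M))"
      by (simp add: q exponent_merge mult_single)
    have letters: "snd p < m" if "p \<in> set L" for p
      using biwords_letters_below[OF _ m] LM that by blast
    \<comment> \<open>Letters of \<open>u\<close> are below \<open>m \<le> n\<close> and shifted letters of \<open>v\<close> are above \<open>n\<close>.\<close>
    have "n \<notin> snd ` set (merge n L M)"
      using letters assms(4,5) biwords_letters_pos LM(2) by (fastforce simp: set_merge)
    moreover have "sorted (map column_key (merge n L M))" by (simp add: merge_def)
    ultimately have "merge n L M \<in> biwords (perm_times n u v)"
      unfolding split low_high[OF LM] using LM by simp
    \<comment> \<open>In a column of \<open>u\<close> the bound by the letter implies the bound by \<open>k\<close>, since letters are below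
       \<open>m \<le> k\<close>; in a shifted column of \<open>v\<close> the letter exceeds \<open>n \<ge> k\<close>, so the bound by \<open>k\<close> implies
       the bound by the letter.\<close>
    moreover have "fst p \<le> snd p \<and> fst p \<le> k" if "p \<in> set (merge n L M)" for p
      using that letters LM assms(4,5) by (fastforce simp: set_merge)
    ultimately show "(case q of (L, M) \<Rightarrow> merge n L M) \<in> ?A" by (simp add: q)
  next
    fix L assume L: "L \<in> ?A"
    then have *: "n \<notin> snd ` set L" "sorted (map column_key L)" "low n L \<in> biwords u" "high n L \<in> biwords v"
      using split by blast+
    show "(case (low n L, high n L) of (L, M) \<Rightarrow> merge n L M) = L"
      using * by (auto intro!: merge_low_high)
    have "\<forall>p\<in>set (low n L). fst p \<le> snd p" "\<forall>p\<in>set (high n L). fst p \<le> k"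
      using L by (auto simp: low_def high_def)
    with * show "(low n L, high n L) \<in> ?B \<times> ?C" by simp
  qed
  also have "\<dots> = set_zero_above k (Poly_Mapping.lookup (schubert (perm_times n u v)))"
    by (rule set_zero_above_schubert_eq_sum_biwords[OF finite(3), symmetric])
  finally show ?thesis by (rule sym)
qed

end
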